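(* A language $L\subseteq A^*$ belongs to $\mathcal B_1$ if and only if $L$ satisfies the families of ultrafilter equations $\mathcal E_{ab=ba}$, $\mathcal E_{aab=abb}$ and $\mathcal E_{a=a.a}$ for every $a,b\in A$.
   Context: $A$ is a finite alphabet. For $a\in A$, $w\in A^*$, $c_a(w):=\{i<|w|: w_i=a\}$; $\mathcal B_1$ is the Boolean subalgebra of $\mathcal P(A^* )$ generated by the languages $\{w: c_a(w)\cap Q\neq\emptyset\}$ for $a\in A$, $Q\subseteq\mathbb N$ (equivalently, the languages definable by Boolean combinations of sentences $\exists x\,\psi(x)$ with $\psi$ built from letter predicates and unary uniform numerical predicates). For a set $S$, $\beta(S)$ is the set of ultrafilters on $S$; a map $f:S\to T$ extends to $\beta f:\beta(S)\to\beta(T)$, $\beta f(\nu)=\{P\subseteq T: f^{-1}(P)\in\nu\}$. A language $L$ satisfies the equation $\gamma_1\leftrightarrow\gamma_2$ ($\gamma_i\in\beta(A^* )$) if $L\in\gamma_1\iff L\in\gamma_2$. For $n\geq1$, $A^*\otimes\mathbb N^n:=\{(w,j_1,\dots,j_n): j_m<|w| \ \forall m\}$. For maps $p_1,\dots,p_n:D\to\mathbb N$ and $u,v:D\to A^*$ on $D=A^*\otimes\mathbb N^n$, $\mathcal E^{p_1,\dots,p_n}_{u=v}$ is the family of equations $\beta u(\nu)\leftrightarrow\beta v(\nu)$ for all $\nu\in\beta(D)$ with $\beta p_1(\nu)=\dots=\beta p_n(\nu)$. For a word $w$, distinct positions $j_1,\dots,j_m<|w|$ and letters $b_1,\dots,b_m$,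 $w((j_1,\dots,j_m)\to(b_1,\dots,b_m))$ is $w$ with the letter at $j_r$ replaced by $b_r$. Define $f_{a,b}(w,j_1,j_2):=w((j_1,j_2)\to(a,b))$ if $j_1\neq j_2$ and $w$ otherwise; $f_{a,a,b}(w,j_1,j_2,j_3):=w((j_1,j_2,j_3)\to(a,a,b))$ if $j_1,j_2,j_3$ are pairwise distinct and $w$ otherwise (similarly $f_{a,b,b}$); $f_a(w,i):=w(i\to a)$ and $(f_a.a)(w,i):=w(i\to a)\,a$ (append $a$). Let $\pi_r$ denote coordinate projections, $\pi(w,i)=i$ and $|\cdot|(w,i)=|w|$. Then $\mathcal E_{ab=ba}:=\mathcal E^{\pi_1,\pi_2}_{f_{a,b}=f_{b,a}}$, $\mathcal E_{aab=abb}:=\mathcal E^{\pi_1,\pi_2,\pi_3}_{f_{a,a,b}=f_{a,b,b}}$, $\mathcal E_{a=a.a}:=\mathcal E^{\pi,|\cdot|}_{f_a=f_a.a}$. *)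

theory Defs
  imports "HOL-Analysis.Sigma_Algebra"
begin

definition positions :: "'a \<Rightarrow> 'a list \<Rightarrow> nat set" where
  "positions a w = {i. i < length w \<and> w ! i = a}"

definition lang_B1 :: "'a set \<Rightarrow> 'a list set set" where
  "lang_B1 A = algebra (lists A) hull
     {{w \<in> lists A. positions a w \<inter> Q \<noteq> {}} | a Q. a \<in> A}"

definition ultrafilters :: "'s set \<Rightarrow> 's set set set" where
  "ultrafilters S = {U. U \<subseteq> Pow S \<and> S \<in> U \<and> {} \<notin> U
     \<and> (\<forall>P\<in>U. \<forall>Q\<in>U. P \<inter> Q \<in> U)
     \<and> (\<forall>P\<in>U. \<forall>Q. P \<subseteq> Q \<and> Q \<subseteq> S \<longrightarrow> Q \<in> U)
     \<and> (\<forall>P. P \<subseteq> S \<longrightarrow> P \<in> U \<or> S - P \<in> U)}"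

definition ultra_ext :: "'s set \<Rightarrow> 't set \<Rightarrow> ('s \<Rightarrow> 't) \<Rightarrow> 's set set \<Rightarrow> 't set set" where
  "ultra_ext S T f \<nu> = {P. P \<subseteq> T \<and> {x \<in> S. f x \<in> P} \<in> \<nu>}"

text \<open>An equation \<open>\<gamma>\<^sub>1 \<leftrightarrow> \<gamma>\<^sub>2\<close> is represented by the pair \<open>(\<gamma>\<^sub>1, \<gamma>\<^sub>2)\<close>.\<close>

definition satisfies :: "'a list set \<Rightarrow> ('a list set set \<times> 'a list set set) set \<Rightarrow> bool" where
  "satisfies L E \<longleftrightarrow> (\<forall>(\<gamma>\<^sub>1, \<gamma>\<^sub>2) \<in> E. L \<in> \<gamma>\<^sub>1 \<longleftrightarrow> L \<in> \<gamma>\<^sub>2)"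

text \<open>The tuple \<open>(w, j\<^sub>1, \<dots>, j\<^sub>n)\<close> is represented as \<open>(w, [j\<^sub>1, \<dots>, j\<^sub>n])\<close>.\<close>

definition tensor :: "'a set \<Rightarrow> nat \<Rightarrow> ('a list \<times> nat list) set" where
  "tensor A n = {(w, js). w \<in> lists A \<and> length js = n \<and> (\<forall>j \<in> set js. j < length w)}"

text \<open>Coordinates are numbered from 0: \<open>proj r\<close> is \<open>\<pi>\<^sub>r\<^sub>+\<^sub>1\<close>, and \<open>proj 0\<close> is also the \<open>\<pi>\<close> of
  the case \<open>n = 1\<close>.\<close>

definition proj :: "nat \<Rightarrow> 'a list \<times> nat list \<Rightarrow> nat" where
  "proj r x = snd x ! r"

definition word_length :: "'a list \<times> nat list \<Rightarrow> nat" where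
  "word_length x = length (fst x)"

definition equations ::
  "'a set \<Rightarrow> nat \<Rightarrow> ('a list \<times> nat list \<Rightarrow> nat) set \<Rightarrow>
   ('a list \<times> nat list \<Rightarrow> 'a list) \<Rightarrow> ('a list \<times> nat list \<Rightarrow> 'a list) \<Rightarrow>
   ('a list set set \<times> 'a list set set) set" where
  "equations A n ps u v =
     {(ultra_ext (tensor A n) (lists A) u \<nu>, ultra_ext (tensor A n) (lists A) v \<nu>) | \<nu>.
        \<nu> \<in> ultrafilters (tensor A n) \<and>
        (\<forall>p\<in>ps. \<forall>q\<in>ps. ultra_ext (tensor A n) UNIV p \<nu> = ultra_ext (tensor A n) UNIV q \<nu>)}"

definition replace :: "'a list \<Rightarrow> nat list \<Rightarrow> 'a list \<Rightarrow> 'a list" where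
  "replace w js bs = fold (\<lambda>(j, b) v. v[j := b]) (zip js bs) w"

text \<open>\<open>subst_letters [b\<^sub>1, \<dots>, b\<^sub>n]\<close> is \<open>f\<close> with indices \<open>b\<^sub>1, \<dots>, b\<^sub>n\<close>; the distinctness test is
  vacuous for \<open>n = 1\<close>.\<close>

definition subst_letters :: "'a list \<Rightarrow> 'a list \<times> nat list \<Rightarrow> 'a list" where
  "subst_letters bs x = (case x of (w, js) \<Rightarrow> if distinct js then replace w js bs else w)"

definition eqs_ab_ba :: "'a set \<Rightarrow> 'a \<Rightarrow> 'a \<Rightarrow> ('a list set set \<times> 'a list set set) set" where
  "eqs_ab_ba A a b =
     equations A 2 {proj 0, proj 1} (subst_letters [a, b]) (subst_letters [b, a])"

definition eqs_aab_abb :: "'a set \<Rightarrow> 'a \<Rightarrow> 'a \<Rightarrow> ('a list set set \<times> 'a list set set) set" where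
  "eqs_aab_abb A a b =
     equations A 3 {proj 0, proj 1, proj 2} (subst_letters [a, a, b]) (subst_letters [a, b, b])"

definition eqs_a_aa :: "'a set \<Rightarrow> 'a \<Rightarrow> ('a list set set \<times> 'a list set set) set" where
  "eqs_a_aa A a =
     equations A 1 {proj 0, word_length} (subst_letters [a]) (\<lambda>x. subst_letters [a] x @ [a])"

end

theory Submission
  imports Defs
begin

text \<open>
  By compactness of the space of ultrafilters, a family of equations holds for \<open>L\<close> iff there is a
  finite set \<open>F\<close> of subsets of \<open>\<nat>\<close> such that \<open>u x \<in> L \<longleftrightarrow> v x \<in> L\<close> whenever the values \<open>p x\<close> all have
  the same \<open>F\<close>-colour, i.e. lie in the same members of \<open>F\<close>. In this form the languages satisfying the
  equations clearly form a Boolean algebra, and the generators are handled by \<open>F = {Q}\<close>.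

  Conversely, choose one \<open>F\<close> for all letters. Within a colour class, letters may be swapped, and a
  repeated letter may be overwritten by another letter of the class, so membership in \<open>L\<close> depends
  only on the length of a word and on the set of pairs (letter, colour) occurring in it (its
  profile). If \<open>N\<close> is so large that every colour occurs below \<open>N\<close>, a word of length at least \<open>N\<close> can
  be prolonged without changing its profile or its membership in \<open>L\<close>. Hence the profile with
  respect to \<open>F\<close> together with the singletons \<open>{i}\<close>, \<open>i < N\<close>, determines membership, and there are
  finitely many profiles.
\<close>

section \<open>Existence and logical properties of ultrafilters\<close>

text \<open>By Zorn's lemma some family containing \<open>G\<close> is maximal with the finite
  intersection property relative to \<open>S\<close>, and maximality makes it an ultrafilter. The
  case \<open>H = {}\<close> of the hypothesis says that \<open>S\<close> is nonempty.\<close>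

lemma ultrafilter_extension:
  assumes sub: "G \<subseteq> Pow S"
    and fip: "\<And>H. finite H \<Longrightarrow> H \<subseteq> G \<Longrightarrow> S \<inter> \<Inter>H \<noteq> {}"
  shows "\<exists>U \<in> ultrafilters S. G \<subseteq> U"
proof -
  define Z where "Z = {V. G \<subseteq> V \<and> V \<subseteq> Pow S \<and> (\<forall>H. finite H \<and> H \<subseteq> V \<longrightarrow> S \<inter> \<Inter>H \<noteq> {})}"
  have "G \<in> Z" using assms by (auto simp: Z_def)
  have "\<exists>U\<in>Z. \<forall>X\<in>Z. U \<subseteq> X \<longrightarrow> X = U"
  proof (rule subset_Zorn_nonempty)
    show "Z \<noteq> {}" using \<open>G \<in> Z\<close> by auto
    fix C assume ne: "C \<noteq> {}" and ch: "subset.chain Z C"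
    have CZ: "C \<subseteq> Z" using ch by (simp add: subset_chain_def)
    have "S \<inter> \<Inter>H \<noteq> {}" if H: "finite H" "H \<subseteq> \<Union>C" for H
    proof -
      obtain V where "V \<in> C" "H \<subseteq> V"
        using finite_subset_Union_chain[OF H ne ch] by blast
      then show ?thesis using CZ H by (auto simp: Z_def)
    qed
    moreover have "G \<subseteq> \<Union>C"
    proof -
      obtain V where "V \<in> C" using ne by blast
      moreover have "G \<subseteq> V" using \<open>V \<in> C\<close> CZ by (auto simp: Z_def)
      ultimately show ?thesis by blast
    qed
    moreover have "\<Union>C \<subseteq> Pow S" using CZ by (auto simp: Z_def)
    ultimately show "\<Union>C \<in> Z" by (simp add: Z_def)
  qed
  then obtain U where UZ: "U \<in> Z" and max: "\<And>V. V \<in> Z \<Longrightarrow> U \<subseteq> V \<Longrightarrow> V = U" by blast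
  have US: "U \<subseteq> Pow S" and GU: "G \<subseteq> U"
    and Ufip: "\<And>H. finite H \<Longrightarrow> H \<subseteq> U \<Longrightarrow> S \<inter> \<Inter>H \<noteq> {}"
    using UZ by (auto simp: Z_def)
  \<comment> \<open>Maximality in usable form; the membership axioms of an ultrafilter are all
    derived from it below.\<close>
  have add: "P \<in> U" if PS: "P \<subseteq> S"
    and meet: "\<And>H. finite H \<Longrightarrow> H \<subseteq> U \<Longrightarrow> S \<inter> \<Inter>H \<inter> P \<noteq> {}" for P
  proof -
    have "S \<inter> \<Inter>H \<noteq> {}" if "finite H" "H \<subseteq> insert P U" for H
    proof -
      have "S \<inter> \<Inter>(H - {P}) \<inter> P \<noteq> {}" using that by (intro meet) auto
      then show ?thesis by blast
    qed
    moreover have "G \<subseteq> insert P U" "insert P U \<subseteq> Pow S" using PS US GU by auto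
    ultimately have "insert P U \<in> Z" unfolding Z_def by (intro CollectI conjI allI impI) auto
    then show ?thesis using max by blast
  qed
  \<comment> \<open>The choice \<open>Q = P \<inter> R\<close> gives closure under intersections,
    the choice \<open>R = P\<close> closure under supersets.\<close>
  have up: "Q \<in> U" if "P \<in> U" "R \<in> U" "P \<inter> R \<subseteq> Q" "Q \<subseteq> S" for P Q R
  proof (rule add[OF \<open>Q \<subseteq> S\<close>])
    fix H assume "finite H" "H \<subseteq> U"
    then have "S \<inter> \<Inter>(insert P (insert R H)) \<noteq> {}" using that by (intro Ufip) auto
    then show "S \<inter> \<Inter>H \<inter> Q \<noteq> {}" using that by auto
  qed
  have cover: "P \<in> U \<or> S - P \<in> U" if PS: "P \<subseteq> S" for P
  proof (rule ccontr)
    assume "\<not> ?thesis"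
    then have "P \<notin> U" "S - P \<notin> U" by auto
    then obtain H H' where H: "finite H" "H \<subseteq> U" "S \<inter> \<Inter>H \<inter> P = {}"
      and H': "finite H'" "H' \<subseteq> U" "S \<inter> \<Inter>H' \<inter> (S - P) = {}"
      using add[of P] add[of "S - P"] PS by blast
    \<comment> \<open>A point of \<open>S\<close> common to all members of \<open>H\<close> and
      \<open>H'\<close> would lie neither in \<open>P\<close> nor in \<open>S - P\<close>.\<close>
    have "S \<inter> \<Inter>(H \<union> H') \<noteq> {}" using H H' by (intro Ufip) auto
    then show False using H H' by blast
  qed
  have "S \<in> U" by (rule add) (use Ufip in auto)
  moreover have "{} \<notin> U" using Ufip[of "{{}}"] by auto
  moreover have "P \<inter> Q \<in> U" if "P \<in> U" "Q \<in> U" for P Q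
    by (rule up[of P Q]) (use that US in auto)
  moreover have "Q \<in> U" if "P \<in> U" "P \<subseteq> Q" "Q \<subseteq> S" for P Q
    by (rule up[of P P]) (use that US in auto)
  ultimately have "U \<in> ultrafilters S"
    using US cover unfolding ultrafilters_def by blast
  then show ?thesis using GU by blast
qed

lemma ultrafilter_Int: "U \<in> ultrafilters S \<Longrightarrow> P \<in> U \<Longrightarrow> Q \<in> U \<Longrightarrow> P \<inter> Q \<in> U"
  by (auto simp: ultrafilters_def)

lemma ultrafilter_mono: "U \<in> ultrafilters S \<Longrightarrow> P \<in> U \<Longrightarrow> P \<subseteq> Q \<Longrightarrow> Q \<subseteq> S \<Longrightarrow> Q \<in> U"
  unfolding ultrafilters_def by blast

lemma ultrafilter_compl: "U \<in> ultrafilters S \<Longrightarrow> P \<subseteq> S \<Longrightarrow> S - P \<in> U \<longleftrightarrow> P \<notin> U"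
  unfolding ultrafilters_def by (metis (mono_tags, lifting) Diff_disjoint mem_Collect_eq)

lemma ultrafilter_Ball:
  assumes U: "U \<in> ultrafilters S" and fin: "finite I"
    and mem: "\<And>i. i \<in> I \<Longrightarrow> {x \<in> S. R i x} \<in> U"
  shows "{x \<in> S. \<forall>i\<in>I. R i x} \<in> U"
  using fin mem
proof (induction I)
  case empty
  then show ?case using U by (simp add: ultrafilters_def)
next
  case (insert i I)
  then have "{x \<in> S. R i x} \<inter> {x \<in> S. \<forall>i\<in>I. R i x} \<in> U"
    by (intro ultrafilter_Int[OF U]) auto
  also have "{x \<in> S. R i x} \<inter> {x \<in> S. \<forall>i\<in>I. R i x} = {x \<in> S. \<forall>i\<in>insert i I. R i x}" by auto
  finally show ?case .
qed

text \<open>Ultrafilters commute with Boolean connectives. Through this, both an equation and the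
  equality of two image ultrafilters become statements that certain sets belong to the
  ultrafilter.\<close>

lemma ultrafilter_iff:
  assumes U: "U \<in> ultrafilters S"
  shows "{x \<in> S. P x \<longleftrightarrow> Q x} \<in> U \<longleftrightarrow> ({x \<in> S. P x} \<in> U \<longleftrightarrow> {x \<in> S. Q x} \<in> U)"
proof -
  have *: "{x \<in> S. R x} \<in> U \<Longrightarrow> {x \<in> S. R' x} \<in> U \<Longrightarrow> (\<And>x. R x \<Longrightarrow> R' x \<Longrightarrow> R'' x) \<Longrightarrow>
      {x \<in> S. R'' x} \<in> U" for R R' R''
    by (rule ultrafilter_mono[OF U ultrafilter_Int[OF U, of "{x \<in> S. R x}" "{x \<in> S. R' x}"]]) auto
  have neg: "{x \<in> S. \<not> R x} \<in> U \<longleftrightarrow> {x \<in> S. R x} \<notin> U" for R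
  proof -
    have "S - {x \<in> S. R x} = {x \<in> S. \<not> R x}" by auto
    then show ?thesis using ultrafilter_compl[OF U, of "{x \<in> S. R x}"] by auto
  qed
  show ?thesis
    using *[of P Q "\<lambda>x. P x \<longleftrightarrow> Q x"] *[of "\<lambda>x. \<not> P x" "\<lambda>x. \<not> Q x" "\<lambda>x. P x \<longleftrightarrow> Q x"]
      *[of "\<lambda>x. P x \<longleftrightarrow> Q x" P Q] *[of "\<lambda>x. P x \<longleftrightarrow> Q x" Q P] neg by blast
qed

section \<open>Colourings and the compactness argument\<close>

text \<open>Equality of \<open>F\<close>-colours. For finite \<open>F\<close> it approximates
  equality of ultrafilters on the natural numbers.\<close>

definition agree :: "nat set set \<Rightarrow> nat \<Rightarrow> nat \<Rightarrow> bool" where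
  "agree F i j \<longleftrightarrow> (\<forall>Q\<in>F. i \<in> Q \<longleftrightarrow> j \<in> Q)"

text \<open>The finite counterpart of an equation family: equality of the image ultrafilters under
  \<open>ps\<close> is replaced by equality of the \<open>F\<close>-colours of the values.\<close>

definition indistinguishes ::
  "nat set set \<Rightarrow> 's set \<Rightarrow> ('s \<Rightarrow> nat) set \<Rightarrow> ('s \<Rightarrow> 't) \<Rightarrow> ('s \<Rightarrow> 't) \<Rightarrow> 't set \<Rightarrow> bool" where
  "indistinguishes F S ps u v L \<longleftrightarrow>
     (\<forall>x\<in>S. (\<forall>p\<in>ps. \<forall>q\<in>ps. agree F (p x) (q x)) \<longrightarrow> (u x \<in> L \<longleftrightarrow> v x \<in> L))"

lemma agree_iff: "agree F i j \<longleftrightarrow> {Q \<in> F. i \<in> Q} = {Q \<in> F. j \<in> Q}"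
  by (auto simp: agree_def)

lemma agree_refl [simp]: "agree F i i" and agree_sym: "agree F i j \<Longrightarrow> agree F j i"
  and agree_trans: "agree F i j \<Longrightarrow> agree F j k \<Longrightarrow> agree F i k"
  by (auto simp: agree_def)

text \<open>Agreement is an equivalence relation, so comparison with the single map
  \<open>p0\<close> suffices.\<close>

lemma pairwise_agree_insert:
  "(\<forall>p\<in>insert p0 P. \<forall>q\<in>insert p0 P. agree F (p x) (q x)) \<longleftrightarrow> (\<forall>q\<in>P. agree F (p0 x) (q x))"
  by (metis agree_refl agree_sym agree_trans insert_iff)

lemma agree_mono: "agree F i j \<Longrightarrow> F' \<subseteq> F \<Longrightarrow> agree F' i j"
  by (auto simp: agree_def)

lemma indistinguishes_mono:
  "indistinguishes F S ps u v L \<Longrightarrow> F \<subseteq> F' \<Longrightarrow> indistinguishes F' S ps u v L"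
  unfolding indistinguishes_def using agree_mono by blast

text \<open>If every finite \<open>F\<close> fails, the set of counterexamples together with the
  sets \<open>{x \<in> S. eq Q x}\<close> has the finite intersection property, and an ultrafilter
  containing them violates an equation. Conversely, for a good finite \<open>F\<close> the
  intersection of these sets over \<open>Q \<in> F\<close> lies in every admissible \<nu> and
  contains no counterexample.\<close>

lemma satisfies_equations_iff:
  assumes L: "L \<subseteq> lists A" and ps: "finite ps"
  shows "satisfies L (equations A n ps u v) \<longleftrightarrow>
    (\<exists>F. finite F \<and> indistinguishes F (tensor A n) ps u v L)"
proof -
  define S where "S = tensor A n"
  define eq where "eq Q x \<longleftrightarrow> (\<forall>p\<in>ps. \<forall>q\<in>ps. p x \<in> Q \<longleftrightarrow> q x \<in> Q)" for Q x
  have ext: "ultra_ext S UNIV p \<nu> = ultra_ext S UNIV q \<nu> \<longleftrightarrow>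
      (\<forall>Q. {x \<in> S. p x \<in> Q \<longleftrightarrow> q x \<in> Q} \<in> \<nu>)" if "\<nu> \<in> ultrafilters S" for \<nu> and p q :: "_ \<Rightarrow> nat"
    using ultrafilter_iff[OF that] by (auto simp: ultra_ext_def set_eq_iff)
  \<comment> \<open>Since \<open>ps\<close> is finite, the conditions on pairs of maps merge into
    one set for each \<open>Q\<close>.\<close>
  have all: "(\<forall>p\<in>ps. \<forall>q\<in>ps. ultra_ext S UNIV p \<nu> = ultra_ext S UNIV q \<nu>) \<longleftrightarrow>
      (\<forall>Q. {x \<in> S. eq Q x} \<in> \<nu>)" if \<nu>: "\<nu> \<in> ultrafilters S" for \<nu>
  proof -
    have "{x \<in> S. eq Q x} \<in> \<nu>" if "\<And>p q. p \<in> ps \<Longrightarrow> q \<in> ps \<Longrightarrow> {x \<in> S. p x \<in> Q \<longleftrightarrow> q x \<in> Q} \<in> \<nu>" for Q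
      unfolding eq_def by (intro ultrafilter_Ball[OF \<nu> ps] that)
    moreover have "{x \<in> S. p x \<in> Q \<longleftrightarrow> q x \<in> Q} \<in> \<nu>" if "{x \<in> S. eq Q x} \<in> \<nu>" "p \<in> ps" "q \<in> ps" for p q Q
      by (rule ultrafilter_mono[OF \<nu> that(1)]) (use that in \<open>auto simp: eq_def\<close>)
    ultimately show ?thesis using ext[OF \<nu>] by blast
  qed
  have sat: "satisfies L (equations A n ps u v) \<longleftrightarrow>
      (\<forall>\<nu>\<in>ultrafilters S. (\<forall>Q. {x \<in> S. eq Q x} \<in> \<nu>) \<longrightarrow> {x \<in> S. u x \<in> L \<longleftrightarrow> v x \<in> L} \<in> \<nu>)"
  proof -
    have "(L \<in> ultra_ext S (lists A) u \<nu> \<longleftrightarrow> L \<in> ultra_ext S (lists A) v \<nu>) \<longleftrightarrow>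
        {x \<in> S. u x \<in> L \<longleftrightarrow> v x \<in> L} \<in> \<nu>" if "\<nu> \<in> ultrafilters S" for \<nu>
      using L ultrafilter_iff[OF that] by (simp add: ultra_ext_def)
    moreover have "satisfies L (equations A n ps u v) \<longleftrightarrow> (\<forall>\<nu>\<in>ultrafilters S.
        (\<forall>p\<in>ps. \<forall>q\<in>ps. ultra_ext S UNIV p \<nu> = ultra_ext S UNIV q \<nu>) \<longrightarrow>
        (L \<in> ultra_ext S (lists A) u \<nu> \<longleftrightarrow> L \<in> ultra_ext S (lists A) v \<nu>))"
    proof -
      have "(\<forall>(x, y)\<in>{(f \<nu>, g \<nu>) | \<nu>. \<nu> \<in> B \<and> P \<nu>}. R x y) \<longleftrightarrow> (\<forall>\<nu>\<in>B. P \<nu> \<longrightarrow> R (f \<nu>) (g \<nu>))"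
        for f g :: "('a list \<times> nat list) set set \<Rightarrow> 'a list set set" and B P R
        by fastforce
      then show ?thesis unfolding satisfies_def equations_def S_def[symmetric] by (rule trans) simp
    qed
    ultimately show ?thesis using all by simp
  qed
  have agree_eq: "(\<forall>p\<in>ps. \<forall>q\<in>ps. agree F (p x) (q x)) \<longleftrightarrow> (\<forall>Q\<in>F. eq Q x)" for F x
    by (auto simp: agree_def eq_def)
  show ?thesis
  proof
    assume s: "satisfies L (equations A n ps u v)"
    show "\<exists>F. finite F \<and> indistinguishes F (tensor A n) ps u v L"
    proof (rule ccontr)
      assume none: "\<not> ?thesis"
      define D where "D = {x \<in> S. \<not> (u x \<in> L \<longleftrightarrow> v x \<in> L)}"
      define E where "E Q = {x \<in> S. eq Q x}" for Q
      have "\<exists>U\<in>ultrafilters S. insert D (range E) \<subseteq> U"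
      proof (rule ultrafilter_extension)
        show "insert D (range E) \<subseteq> Pow S" by (auto simp: D_def E_def)
        fix H assume H: "finite H" "H \<subseteq> insert D (range E)"
        \<comment> \<open>Apart from \<open>D\<close>, a finite subfamily is indexed by a finite
          \<open>F\<close>. A counterexample to \<open>F\<close> is a point common to the whole
          subfamily.\<close>
        then have "finite (H - {D})" "H - {D} \<subseteq> range E" by auto
        then obtain F where F: "finite F" "H - {D} = E ` F"
          by (meson finite_subset_image)
        have "\<not> indistinguishes F S ps u v L" using none F by (auto simp: S_def)
        then obtain x where "x \<in> D" "\<forall>Q\<in>F. x \<in> E Q"
          unfolding indistinguishes_def agree_eq D_def E_def by blast
        then have "x \<in> S \<inter> \<Inter>H" using F by (auto simp: D_def)
        then show "S \<inter> \<Inter>H \<noteq> {}" by blast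
      qed
      then obtain U where U: "U \<in> ultrafilters S" "D \<in> U" "\<And>Q. E Q \<in> U" by blast
      then have "{x \<in> S. u x \<in> L \<longleftrightarrow> v x \<in> L} \<in> U" using s sat by (auto simp: E_def)
      then have "D \<inter> {x \<in> S. u x \<in> L \<longleftrightarrow> v x \<in> L} \<in> U" using ultrafilter_Int U by blast
      moreover have "D \<inter> {x \<in> S. u x \<in> L \<longleftrightarrow> v x \<in> L} = {}" by (auto simp: D_def)
      ultimately show False using U(1) by (simp add: ultrafilters_def)
    qed
  next
    assume "\<exists>F. finite F \<and> indistinguishes F (tensor A n) ps u v L"
    then obtain F where F: "finite F" "indistinguishes F S ps u v L" by (auto simp: S_def)
    show "satisfies L (equations A n ps u v)"
      unfolding sat
    proof (intro ballI impI)
      fix \<nu> assume \<nu>: "\<nu> \<in> ultrafilters S" and eq: "\<forall>Q. {x \<in> S. eq Q x} \<in> \<nu>"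
      have "{x \<in> S. \<forall>Q\<in>F. eq Q x} \<in> \<nu>" by (rule ultrafilter_Ball[OF \<nu> F(1)]) (use eq in auto)
      then show "{x \<in> S. u x \<in> L \<longleftrightarrow> v x \<in> L} \<in> \<nu>"
        by (rule ultrafilter_mono[OF \<nu>]) (use F(2) in \<open>auto simp: indistinguishes_def agree_eq\<close>)
    qed
  qed
qed

section \<open>Boolean closure of the solutions\<close>

text \<open>In the finite form, a complement keeps the same \<open>F\<close>, because
  \<open>u\<close> and \<open>v\<close> take values in \<open>lists A\<close>, and a union is
  handled by the union of the two colourings.\<close>

lemma algebra_satisfying:
  assumes ps: "finite ps" and u: "\<forall>x\<in>tensor A n. u x \<in> lists A" and v: "\<forall>x\<in>tensor A n. v x \<in> lists A"
  shows "algebra (lists A) {L. L \<subseteq> lists A \<and> satisfies L (equations A n ps u v)}"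
proof -
  have "satisfies {} (equations A n ps u v)"
    by (subst satisfies_equations_iff[OF _ ps]) (auto simp: indistinguishes_def)
  moreover have "satisfies (lists A - L) (equations A n ps u v)"
    if "L \<subseteq> lists A" "satisfies L (equations A n ps u v)" for L
    using that satisfies_equations_iff[OF _ ps, of L A n u v]
      satisfies_equations_iff[OF _ ps, of "lists A - L" A n u v] u v
    by (auto simp: indistinguishes_def)
  moreover have "satisfies (L \<union> M) (equations A n ps u v)"
    if L: "L \<subseteq> lists A" "satisfies L (equations A n ps u v)"
      and M: "M \<subseteq> lists A" "satisfies M (equations A n ps u v)" for L M
  proof -
    obtain F where F: "finite F" "indistinguishes F (tensor A n) ps u v L"
      using L(2) unfolding satisfies_equations_iff[OF L(1) ps] by blast
    obtain G where G: "finite G" "indistinguishes G (tensor A n) ps u v M"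
      using M(2) unfolding satisfies_equations_iff[OF M(1) ps] by blast
    have "indistinguishes (F \<union> G) (tensor A n) ps u v (L \<union> M)"
      using indistinguishes_mono[OF F(2), of "F \<union> G"] indistinguishes_mono[OF G(2), of "F \<union> G"]
      by (simp add: indistinguishes_def)
    moreover have "L \<union> M \<subseteq> lists A" "finite (F \<union> G)" using L(1) M(1) F(1) G(1) by auto
    ultimately show ?thesis using satisfies_equations_iff[OF _ ps] by blast
  qed
  ultimately show ?thesis by (auto simp: algebra_iff_Un)
qed

section \<open>Explicit finite forms of the three families\<close>

lemma ball_tensor_1:
  "(\<forall>x\<in>tensor A (Suc 0). P x) \<longleftrightarrow> (\<forall>w\<in>lists A. \<forall>i<length w. P (w, [i]))"
proof -
  have *: "tensor A (Suc 0) = {(w, [i]) | w i. w \<in> lists A \<and> i < length w}"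
    by (auto simp: tensor_def length_Suc_conv)
  show ?thesis unfolding * Ball_def mem_Collect_eq by metis
qed

lemma ball_tensor_2:
  "(\<forall>x\<in>tensor A 2. P x) \<longleftrightarrow> (\<forall>w\<in>lists A. \<forall>i<length w. \<forall>j<length w. P (w, [i, j]))"
proof -
  have *: "tensor A 2 = {(w, [i, j]) | w i j. w \<in> lists A \<and> i < length w \<and> j < length w}"
    by (auto simp: tensor_def length_Suc_conv numeral_eq_Suc)
  show ?thesis unfolding * Ball_def mem_Collect_eq by metis
qed

lemma ball_tensor_3:
  "(\<forall>x\<in>tensor A 3. P x) \<longleftrightarrow>
    (\<forall>w\<in>lists A. \<forall>i<length w. \<forall>j<length w. \<forall>k<length w. P (w, [i, j, k]))"
proof -
  have *: "tensor A 3 =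
      {(w, [i, j, k]) | w i j k. w \<in> lists A \<and> i < length w \<and> j < length w \<and> k < length w}"
    by (auto simp: tensor_def length_Suc_conv numeral_eq_Suc)
  show ?thesis unfolding * Ball_def mem_Collect_eq by metis
qed

lemma list_update_in_lists: "w \<in> lists A \<Longrightarrow> a \<in> A \<Longrightarrow> w[i := a] \<in> lists A"
  using set_update_subset_insert[of w i a] by (auto simp: in_lists_conv_set)

text \<open>For coinciding positions both sides of the equation are \<open>w\<close> itself, so only
  distinct positions impose a condition.\<close>

lemma satisfies_ab_ba_iff:
  assumes "L \<subseteq> lists A"
  shows "satisfies L (eqs_ab_ba A a b) \<longleftrightarrow> (\<exists>F. finite F \<and>
    (\<forall>w\<in>lists A. \<forall>i<length w. \<forall>j<length w. i \<noteq> j \<longrightarrow> agree F i j \<longrightarrow>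
      (w[i := a, j := b] \<in> L \<longleftrightarrow> w[i := b, j := a] \<in> L)))"
proof -
  have "satisfies L (eqs_ab_ba A a b) \<longleftrightarrow> (\<exists>F. finite F \<and> indistinguishes F (tensor A 2)
      {proj 0, proj 1} (subst_letters [a, b]) (subst_letters [b, a]) L)"
    unfolding eqs_ab_ba_def by (rule satisfies_equations_iff[OF assms]) simp
  then show ?thesis
    unfolding indistinguishes_def pairwise_agree_insert One_nat_def ball_tensor_2
    by (simp add: subst_letters_def replace_def proj_def word_length_def)
      (intro ex_cong1 conj_cong ball_cong all_cong refl, auto)
qed

lemma satisfies_aab_abb_iff:
  assumes "L \<subseteq> lists A"
  shows "satisfies L (eqs_aab_abb A a b) \<longleftrightarrow> (\<exists>F. finite F \<and>
    (\<forall>w\<in>lists A. \<forall>i<length w. \<forall>j<length w. \<forall>k<length w. distinct [i, j, k] \<longrightarrow>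
      agree F i j \<longrightarrow> agree F i k \<longrightarrow>
      (w[i := a, j := a, k := b] \<in> L \<longleftrightarrow> w[i := a, j := b, k := b] \<in> L)))"
proof -
  have "satisfies L (eqs_aab_abb A a b) \<longleftrightarrow> (\<exists>F. finite F \<and> indistinguishes F (tensor A 3)
      {proj 0, proj 1, proj 2} (subst_letters [a, a, b]) (subst_letters [a, b, b]) L)"
    unfolding eqs_aab_abb_def by (rule satisfies_equations_iff[OF assms]) simp
  then show ?thesis
    unfolding indistinguishes_def pairwise_agree_insert One_nat_def ball_tensor_3
    by (simp add: subst_letters_def replace_def proj_def word_length_def)
      (intro ex_cong1 conj_cong ball_cong all_cong refl, auto)
qed

text \<open>The appended letter occupies position \<open>length w\<close>, whose colour is therefore
  compared with that of \<open>i\<close>.\<close>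

lemma satisfies_a_aa_iff:
  assumes "L \<subseteq> lists A"
  shows "satisfies L (eqs_a_aa A a) \<longleftrightarrow> (\<exists>F. finite F \<and>
    (\<forall>w\<in>lists A. \<forall>i<length w. agree F i (length w) \<longrightarrow>
      (w[i := a] \<in> L \<longleftrightarrow> w[i := a] @ [a] \<in> L)))"
proof -
  have "satisfies L (eqs_a_aa A a) \<longleftrightarrow> (\<exists>F. finite F \<and> indistinguishes F (tensor A 1)
      {proj 0, word_length} (subst_letters [a]) (\<lambda>x. subst_letters [a] x @ [a]) L)"
    unfolding eqs_a_aa_def by (rule satisfies_equations_iff[OF assms]) simp
  then show ?thesis
    unfolding indistinguishes_def pairwise_agree_insert One_nat_def ball_tensor_1
    by (simp add: subst_letters_def replace_def proj_def word_length_def)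
qed

section \<open>Languages of the algebra satisfy the equations\<close>

lemma positions_list_update:
  "i < length w \<Longrightarrow> positions c (w[i := a]) = positions c w - {i} \<union> (if a = c then {i} else {})"
  by (auto simp: positions_def nth_list_update)

lemma positions_snoc:
  "positions c (w @ [a]) = positions c w \<union> (if a = c then {length w} else {})"
  by (auto simp: positions_def nth_append less_Suc_eq split: if_splits)

text \<open>With the colouring \<open>{Q}\<close>, positions of one colour lie all inside or all
  outside \<open>Q\<close>. In each equation the changed positions carry the same set of letters on
  both sides, so the letters occurring inside \<open>Q\<close> are the same.\<close>

lemma generator_satisfies:
  fixes A :: "'a set" and c :: 'a and Q :: "nat set"
  assumes "a \<in> A" "b \<in> A"
  defines "G \<equiv> {w \<in> lists A. positions c w \<inter> Q \<noteq> {}}"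
  shows "satisfies G (eqs_ab_ba A a b)" "satisfies G (eqs_aab_abb A a b)"
    "satisfies G (eqs_a_aa A a)"
proof -
  have G: "G \<subseteq> lists A" by (auto simp: G_def)
  have mem: "w \<in> G \<longleftrightarrow> w \<in> lists A \<and> positions c w \<inter> Q \<noteq> {}" for w by (simp add: G_def)
  have Q: "agree {Q} i j \<longleftrightarrow> (i \<in> Q \<longleftrightarrow> j \<in> Q)" for i j by (simp add: agree_def)
  show "satisfies G (eqs_ab_ba A a b)"
    unfolding satisfies_ab_ba_iff[OF G]
    by (rule exI[of _ "{Q}"])
      (auto simp: mem Q positions_list_update list_update_in_lists assms(1,2) del: in_listsD in_listsI)
  show "satisfies G (eqs_aab_abb A a b)"
    unfolding satisfies_aab_abb_iff[OF G]
    by (rule exI[of _ "{Q}"])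
      (auto simp: mem Q positions_list_update list_update_in_lists assms(1,2) del: in_listsD in_listsI)
  show "satisfies G (eqs_a_aa A a)"
    unfolding satisfies_a_aa_iff[OF G]
    by (rule exI[of _ "{Q}"])
      (auto simp: mem Q positions_list_update positions_snoc list_update_in_lists assms(1,2)
        del: in_listsD in_listsI)
qed

lemma lang_B1_satisfies:
  assumes L: "L \<in> lang_B1 A" and ab: "a \<in> A" "b \<in> A"
  shows "satisfies L (eqs_ab_ba A a b)" "satisfies L (eqs_aab_abb A a b)"
    "satisfies L (eqs_a_aa A a)"
proof -
  \<comment> \<open>The hull is the least algebra containing the generators; this is applied to the
    solution set of each family.\<close>
  have B1: "L \<in> T" if "algebra (lists A) T"
      "\<And>c Q. {w \<in> lists A. positions c w \<inter> Q \<noteq> {}} \<in> T" for T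
    using L that unfolding lang_B1_def hull_def by blast
  note G = generator_satisfies[OF ab]
  note upd = list_update_in_lists[OF _ ab(1)] list_update_in_lists[OF _ ab(2)]
  have "L \<in> {L. L \<subseteq> lists A \<and> satisfies L (eqs_ab_ba A a b)}"
  proof (rule B1)
    show "algebra (lists A) {L. L \<subseteq> lists A \<and> satisfies L (eqs_ab_ba A a b)}"
      unfolding eqs_ab_ba_def
      by (rule algebra_satisfying)
        (auto simp: ball_tensor_2 subst_letters_def replace_def upd del: in_listsD in_listsI)
  qed (use G in auto)
  then show "satisfies L (eqs_ab_ba A a b)" by simp
  have "L \<in> {L. L \<subseteq> lists A \<and> satisfies L (eqs_aab_abb A a b)}"
  proof (rule B1)
    show "algebra (lists A) {L. L \<subseteq> lists A \<and> satisfies L (eqs_aab_abb A a b)}"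
      unfolding eqs_aab_abb_def
      by (rule algebra_satisfying)
        (auto simp: ball_tensor_3 subst_letters_def replace_def upd del: in_listsD in_listsI)
  qed (use G in auto)
  then show "satisfies L (eqs_aab_abb A a b)" by simp
  have "L \<in> {L. L \<subseteq> lists A \<and> satisfies L (eqs_a_aa A a)}"
  proof (rule B1)
    show "algebra (lists A) {L. L \<subseteq> lists A \<and> satisfies L (eqs_a_aa A a)}"
      unfolding eqs_a_aa_def
      by (rule algebra_satisfying)
        (use ab in \<open>auto simp: ball_tensor_1 subst_letters_def replace_def upd del: in_listsD in_listsI\<close>)
  qed (use G in auto)
  then show "satisfies L (eqs_a_aa A a)" by simp
qed

section \<open>Finite Boolean combinations\<close>

text \<open>Such an \<open>L\<close> is a union of atoms of the finite Boolean algebra generated by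
  the sets \<open>X p\<close>. The induction splits \<open>L\<close> along one \<open>X p\<close>
  and saturates both halves with respect to the remaining sets.\<close>

lemma (in algebra) invariant_in_algebra:
  assumes "finite I" "\<And>p. p \<in> I \<Longrightarrow> X p \<in> M" "L \<subseteq> \<Omega>"
    and "\<And>w w'. w \<in> \<Omega> \<Longrightarrow> w' \<in> \<Omega> \<Longrightarrow> \<forall>p\<in>I. w \<in> X p \<longleftrightarrow> w' \<in> X p \<Longrightarrow> w \<in> L \<Longrightarrow> w' \<in> L"
  shows "L \<in> M"
  using assms
proof (induction I arbitrary: L)
  case empty
  then have "L = {} \<or> L = \<Omega>" by auto
  then show ?case by auto
next
  case (insert p I)
  define sat where "sat K = {w \<in> \<Omega>. \<exists>w'\<in>K. \<forall>q\<in>I. w' \<in> X q \<longleftrightarrow> w \<in> X q}" for K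
  have satM: "sat K \<in> M" for K
    by (rule insert.IH) (use insert.prems(1) in \<open>auto simp: sat_def\<close>)
  \<comment> \<open>Cutting each saturation back to its side of \<open>X p\<close> restores the full
    membership pattern, so invariance of \<open>L\<close> excludes extra points.\<close>
  have "L = (sat (L \<inter> X p) \<inter> X p) \<union> (sat (L - X p) - X p)" (is "_ = ?R")
  proof
    show "L \<subseteq> ?R" using insert.prems(2) by (auto simp: sat_def)
    show "?R \<subseteq> L"
    proof
      fix w assume "w \<in> ?R"
      then obtain w' where "w \<in> \<Omega>" "w' \<in> L" "\<forall>q\<in>insert p I. w' \<in> X q \<longleftrightarrow> w \<in> X q"
        by (auto simp: sat_def)
      then show "w \<in> L" using insert.prems(2,3) by blast
    qed
  qed
  moreover have "?R \<in> M" using satM insert.prems(1)[of p] by auto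
  ultimately show ?case by simp
qed

section \<open>Profiles of words\<close>

text \<open>A colour is encoded as the set of members of \<open>F\<close> containing the position,
  so a finite \<open>F\<close> has finitely many colours.\<close>

definition profile :: "nat set set \<Rightarrow> 'a list \<Rightarrow> ('a \<times> nat set set) set" where
  "profile F w = (\<lambda>i. (w ! i, {Q \<in> F. i \<in> Q})) ` {..<length w}"

lemma profile_subset_iff:
  "profile F w \<subseteq> profile F w' \<longleftrightarrow>
    (\<forall>i<length w. \<exists>j<length w'. w' ! j = w ! i \<and> agree F i j)"
proof -
  have "(\<lambda>i. (f i, c i)) ` {..<n} \<subseteq> (\<lambda>i. (g i, c i)) ` {..<m} \<longleftrightarrow> (\<forall>i<n. \<exists>j<m. g j = f i \<and> c i = c j)"
    for f g :: "nat \<Rightarrow> 'a" and c :: "nat \<Rightarrow> nat set set" and n m :: nat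
    unfolding image_subset_iff image_iff Ball_def Bex_def lessThan_iff prod.inject by metis
  then show ?thesis unfolding profile_def agree_iff .
qed

text \<open>Serves to forget the singletons that are later adjoined to the colouring.\<close>

lemma profile_mono:
  assumes "F \<subseteq> F'" "profile F' w = profile F' w'"
  shows "profile F w = profile F w'"
proof -
  have "profile F' v \<subseteq> profile F' v' \<Longrightarrow> profile F v \<subseteq> profile F v'" for v v' :: "'a list"
    unfolding profile_subset_iff using agree_mono[OF _ assms(1)] by blast
  then show ?thesis using assms(2) by (simp add: set_eq_subset)
qed

text \<open>Every letter stays in its colour class, which gives one inclusion. The swap is an
  involution, so the same inclusion for the swapped word gives the other.\<close>

lemma profile_swap:
  assumes "i < length w" "j < length w" "agree F i j"
  shows "profile F (w[i := w ! j, j := w ! i]) = profile F w"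
proof -
  have sub: "profile F v \<subseteq> profile F (v[i := v ! j, j := v ! i])" if "length v = length w" for v :: "'a list"
    unfolding profile_subset_iff
  proof (intro allI impI)
    fix k assume "k < length v"
    then show "\<exists>l<length (v[i := v ! j, j := v ! i]).
        v[i := v ! j, j := v ! i] ! l = v ! k \<and> agree F k l"
      using that assms agree_sym[OF assms(3)]
      by (intro exI[of _ "if k = i then j else if k = j then i else k"])
        (auto simp: nth_list_update)
  qed
  have "(w[i := w ! j, j := w ! i])[i := w[i := w ! j, j := w ! i] ! j, j := w[i := w ! j, j := w ! i] ! i] = w"
    using assms by (intro nth_equalityI) (auto simp: nth_list_update)
  then show ?thesis using sub[of w] sub[of "w[i := w ! j, j := w ! i]"] by auto
qed

section \<open>Membership is determined by the profile\<close>

text \<open>The finite forms of the three families, with one colouring \<open>F\<close> shared by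
  all letters.\<close>

locale colour_invariant =
  fixes A :: "'a set" and L :: "'a list set" and F :: "nat set set"
  assumes swap: "\<And>a b w i j. \<lbrakk>a \<in> A; b \<in> A; w \<in> lists A; i < length w; j < length w; i \<noteq> j; agree F i j\<rbrakk>
      \<Longrightarrow> w[i := a, j := b] \<in> L \<longleftrightarrow> w[i := b, j := a] \<in> L"
    and absorb: "\<And>a b w i j k. \<lbrakk>a \<in> A; b \<in> A; w \<in> lists A; i < length w; j < length w; k < length w;
        distinct [i, j, k]; agree F i j; agree F i k\<rbrakk>
      \<Longrightarrow> w[i := a, j := a, k := b] \<in> L \<longleftrightarrow> w[i := a, j := b, k := b] \<in> L"
    and extend: "\<And>a w i. \<lbrakk>a \<in> A; w \<in> lists A; i < length w; agree F i (length w)\<rbrakk>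
      \<Longrightarrow> w[i := a] \<in> L \<longleftrightarrow> w[i := a] @ [a] \<in> L"
begin

text \<open>Induction on the number of disagreements. At a disagreement, the letter of \<open>w\<close> is overwritten by
  that of \<open>w'\<close> if it occurs again in the same colour class of \<open>w\<close>, and otherwise it is swapped
  to a position of the class where \<open>w'\<close> carries it.\<close>

lemma same_length_same_profile:
  assumes "w \<in> lists A" "w' \<in> lists A" "length w = length w'" "profile F w = profile F w'"
  shows "w \<in> L \<longleftrightarrow> w' \<in> L"
  using assms
proof (induction "card {i. i < length w \<and> w ! i \<noteq> w' ! i}" arbitrary: w rule: less_induct)
  case less
  let ?D = "\<lambda>v. {i. i < length w' \<and> v ! i \<noteq> w' ! i}"
  have A: "w ! i \<in> A" if "i < length w" for i
    using that less.prems(1) by (auto simp: in_lists_conv_set)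
  have step: "w \<in> L \<longleftrightarrow> w' \<in> L"
    if v: "v \<in> lists A" "length v = length w" "profile F v = profile F w" "?D v \<subset> ?D w"
      and wv: "w \<in> L \<longleftrightarrow> v \<in> L" for v
  proof -
    have "card (?D v) < card (?D w)" by (rule psubset_card_mono) (use v(4) in auto)
    then have "v \<in> L \<longleftrightarrow> w' \<in> L" using v less.prems by (intro less.hyps) auto
    then show ?thesis using wv by simp
  qed
  show ?case
  proof (cases "w = w'")
    case False
    then obtain i where i: "i < length w" "w ! i \<noteq> w' ! i"
      using less.prems(3) nth_equalityI by blast
    have sub: "profile F w \<subseteq> profile F w'" "profile F w' \<subseteq> profile F w" using less.prems(4) by auto
    show ?thesis
    proof (cases "\<exists>k<length w. k \<noteq> i \<and> agree F i k \<and> w ! k = w ! i")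
      case True
      then obtain k where k: "k < length w" "k \<noteq> i" "agree F i k" "w ! k = w ! i" by blast
      obtain j where j: "j < length w" "w ! j = w' ! i" "agree F i j"
        using sub(2) i(1) less.prems(3) unfolding profile_subset_iff by metis
      have ji: "j \<noteq> i" "j \<noteq> k" using i j k by auto
      have ki: "agree F k i" "agree F k j"
        using k(3) j(3) agree_sym agree_trans by blast+
      let ?v = "w[i := w ! j]"
      \<comment> \<open>With a = \<open>w ! i\<close> and b = \<open>w ! j\<close> at the positions
        \<open>k, i, j\<close>, the pattern aab is \<open>w\<close> itself, and abb overwrites
        position \<open>i\<close> by the desired letter \<open>w' ! i\<close>.\<close>
      have "w[k := w ! i, i := w ! i, j := w ! j] \<in> L \<longleftrightarrow> w[k := w ! i, i := w ! j, j := w ! j] \<in> L"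
        using absorb[of "w ! i" "w ! j" w k i j] A i(1) j(1) k(1,2) ji ki less.prems(1) by auto
      moreover have "w[k := w ! i, i := w ! i, j := w ! j] = w"
        using k(4) by (metis list_update_id)
      moreover have "w[k := w ! i, i := w ! j, j := w ! j] = ?v"
        using k(4) ji by (metis list_update_id nth_list_update_neq)
      ultimately have wv: "w \<in> L \<longleftrightarrow> ?v \<in> L" by simp
      \<comment> \<open>The letter lost at \<open>i\<close> survives at \<open>k\<close>; for the
        converse inclusion, the new letter at \<open>i\<close> already occurs at
        \<open>j\<close>.\<close>
      have "profile F w \<subseteq> profile F ?v" unfolding profile_subset_iff
      proof (intro allI impI)
        fix l assume "l < length w"
        then show "\<exists>m<length ?v. ?v ! m = w ! l \<and> agree F l m"
          using k by (intro exI[of _ "if l = i then k else l"]) auto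
      qed
      moreover have "profile F ?v \<subseteq> profile F w" unfolding profile_subset_iff
      proof (intro allI impI)
        fix l assume "l < length ?v"
        then show "\<exists>m<length w. w ! m = ?v ! l \<and> agree F l m"
          using j ji by (intro exI[of _ "if l = i then j else l"]) auto
      qed
      moreover have "?D ?v \<subset> ?D w"
        using i j less.prems(3) by (auto simp: nth_list_update split: if_splits)
      ultimately show ?thesis
        using wv less.prems(1) A[OF j(1)] by (intro step[of ?v] list_update_in_lists) auto
    next
      case False
      obtain j where j: "j < length w" "w' ! j = w ! i" "agree F i j"
        using sub(1) i(1) less.prems(3) unfolding profile_subset_iff by metis
      have ji: "j \<noteq> i" using i j by auto
      \<comment> \<open>As \<open>w ! i\<close> has no second occurrence in its class,
        \<open>j\<close> is a disagreement, which the swap repairs. Position \<open>i\<close> was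
        one already, so no new disagreement arises.\<close>
      have wj: "w ! j \<noteq> w ! i" using False j ji by blast
      let ?v = "w[i := w ! j, j := w ! i]"
      have "w[i := w ! i, j := w ! j] \<in> L \<longleftrightarrow> ?v \<in> L"
        using swap A i(1) j ji less.prems(1) by metis
      then have wv: "w \<in> L \<longleftrightarrow> ?v \<in> L" by simp
      have "?D ?v \<subset> ?D w"
      proof
        show "?D ?v \<subseteq> ?D w" using i j ji less.prems(3) by (auto simp: nth_list_update split: if_splits)
        have "j \<in> ?D w" "j \<notin> ?D ?v" using i j ji wj less.prems(3) by auto
        then show "?D ?v \<noteq> ?D w" by blast
      qed
      then show ?thesis
        using wv less.prems(1) A i(1) j profile_swap[OF i(1) j(1) j(3)]
        by (intro step[of ?v] list_update_in_lists) auto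
    qed
  qed simp
qed

text \<open>Letters are appended one at a time. The new position \<open>n\<close> has the colour of
  some \<open>j < N\<close>, and repeating the letter at \<open>j\<close> adds no new pair to the
  profile.\<close>

lemma extend_to_length:
  assumes N: "\<And>i. i \<ge> N \<Longrightarrow> \<exists>j<N. agree F j i"
    and w: "w \<in> lists A" "N \<le> length w" "length w \<le> n"
  shows "\<exists>v\<in>lists A. length v = n \<and> profile F v = profile F w \<and> (v \<in> L \<longleftrightarrow> w \<in> L)"
  using w(3)
proof (induction n rule: dec_induct)
  case base
  then show ?case using w(1) by blast
next
  case (step n)
  then obtain v where v: "v \<in> lists A" "length v = n" "profile F v = profile F w" "v \<in> L \<longleftrightarrow> w \<in> L"
    by blast
  obtain j where j: "j < n" "agree F j n"
    using N[of n] step.hyps(1) w(2) by (meson le_trans less_le_trans)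
  have vj: "v ! j \<in> A" using j v by (auto simp: in_lists_conv_set)
  \<comment> \<open>Overwriting position \<open>j\<close> by its own letter changes nothing, so
    \<open>extend\<close> compares \<open>v\<close> with its prolongation.\<close>
  have "v[j := v ! j] \<in> L \<longleftrightarrow> v[j := v ! j] @ [v ! j] \<in> L"
    using extend[OF vj v(1)] j v(2) by blast
  then have "v @ [v ! j] \<in> L \<longleftrightarrow> w \<in> L" using v(4) by simp
  moreover have "profile F (v @ [v ! j]) = profile F v"
  proof -
    have "profile F (v @ [v ! j]) = insert (v ! j, {Q \<in> F. n \<in> Q}) (profile F v)"
      using v(2) by (simp add: profile_def lessThan_Suc nth_append)
    moreover have "(v ! j, {Q \<in> F. n \<in> Q}) \<in> profile F v"
      using j v(2) by (auto simp: profile_def agree_iff)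
    ultimately show ?thesis by (simp add: insert_absorb)
  qed
  ultimately show ?case using v vj by (intro bexI[of _ "v @ [v ! j]"]) auto
qed

text \<open>Words of different lengths with equal profiles both have length at least
  \<open>N\<close>, so the shorter one can be prolonged to the length of the other and the case of
  equal lengths applies.\<close>

lemma profile_determines:
  assumes N: "\<And>i. i \<ge> N \<Longrightarrow> \<exists>j<N. agree F j i"
    and w: "w \<in> lists A" "w' \<in> lists A"
    and prof: "profile (F \<union> (\<lambda>i. {i}) ` {..<N}) w = profile (F \<union> (\<lambda>i. {i}) ` {..<N}) w'"
  shows "w \<in> L \<longleftrightarrow> w' \<in> L"
proof -
  let ?F = "F \<union> (\<lambda>i. {i}) ` {..<N}"
  have *: "v \<in> L \<longleftrightarrow> v' \<in> L"
    if v: "v \<in> lists A" "v' \<in> lists A" "profile ?F v = profile ?F v'" "length v \<le> length v'" for v v'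
  proof (cases "length v = length v'")
    case True
    then show ?thesis using v same_length_same_profile profile_mono[OF _ v(3), of F] by blast
  next
    case False
    \<comment> \<open>Otherwise \<open>{length v}\<close> is a member of the colouring and isolates
      the position \<open>length v\<close> of \<open>v'\<close>, whereas \<open>v\<close> has no
      such position.\<close>
    have "N \<le> length v"
    proof (rule ccontr)
      assume "\<not> ?thesis"
      then have "{length v} \<in> ?F" by simp
      moreover obtain j where j: "j < length v" "agree ?F (length v) j"
        using False v(3,4) profile_subset_iff[of ?F v' v] by (auto simp: less_le)
      ultimately have "length v \<in> {length v} \<longleftrightarrow> j \<in> {length v}" by (metis agree_def)
      then show False using j(1) by simp
    qed
    then obtain u where "u \<in> lists A" "length u = length v'" "profile F u = profile F v" "u \<in> L \<longleftrightarrow> v \<in> L"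
      using extend_to_length[OF N v(1) _ v(4)] by blast
    then show ?thesis using same_length_same_profile[of u v'] v(2) profile_mono[OF _ v(3), of F] by auto
  qed
  show ?thesis using *[of w w'] *[of w' w] w prof by (metis nat_le_linear)
qed

end

section \<open>From the equations to membership in the algebra\<close>

text \<open>There are finitely many colours; \<open>N\<close> exceeds a chosen representative of
  each.\<close>

lemma agree_bounded_representatives:
  assumes "finite F"
  shows "\<exists>N. \<forall>i\<ge>N. \<exists>j<N. agree F j i"
proof -
  let ?c = "\<lambda>i. {Q \<in> F. i \<in> Q}"
  have "finite (range ?c)" by (rule finite_subset[of _ "Pow F"]) (use assms in auto)
  then obtain R where R: "finite R" "range ?c = ?c ` R"
    using finite_subset_image[of "range ?c" ?c UNIV] by blast
  obtain N where N: "\<forall>j\<in>R. j < N" using R(1) finite_nat_set_iff_bounded by blast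
  have "\<exists>j<N. agree F j i" for i
  proof -
    have "?c i \<in> ?c ` R" using R(2) by blast
    then show ?thesis unfolding agree_iff using N by (metis (no_types, lifting) imageE)
  qed
  then show ?thesis by blast
qed

text \<open>Each equation family comes with its own finite colouring. The union over the finite
  alphabet is finite and refines all of them, and refinement only strengthens the agreement
  hypotheses.\<close>

lemma satisfies_colour_invariant:
  assumes fin: "finite A" and L: "L \<subseteq> lists A"
    and sat: "\<forall>a\<in>A. \<forall>b\<in>A. satisfies L (eqs_ab_ba A a b) \<and> satisfies L (eqs_aab_abb A a b)
      \<and> satisfies L (eqs_a_aa A a)"
  shows "\<exists>F. finite F \<and> colour_invariant A L F"
proof -
  have "\<forall>p\<in>A \<times> A. \<exists>F. finite F \<and> (\<forall>w\<in>lists A. \<forall>i<length w. \<forall>j<length w. i \<noteq> j \<longrightarrow> agree F i j \<longrightarrow>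
      (w[i := fst p, j := snd p] \<in> L \<longleftrightarrow> w[i := snd p, j := fst p] \<in> L))"
    using sat by (auto simp: satisfies_ab_ba_iff[OF L])
  then obtain F1 where F1: "\<And>p. p \<in> A \<times> A \<Longrightarrow> finite (F1 p)"
    "\<And>p w i j. p \<in> A \<times> A \<Longrightarrow> w \<in> lists A \<Longrightarrow> i < length w \<Longrightarrow> j < length w \<Longrightarrow> i \<noteq> j \<Longrightarrow> agree (F1 p) i j \<Longrightarrow>
      w[i := fst p, j := snd p] \<in> L \<longleftrightarrow> w[i := snd p, j := fst p] \<in> L"
    by metis
  have "\<forall>p\<in>A \<times> A. \<exists>F. finite F \<and> (\<forall>w\<in>lists A. \<forall>i<length w. \<forall>j<length w. \<forall>k<length w.
      distinct [i, j, k] \<longrightarrow> agree F i j \<longrightarrow> agree F i k \<longrightarrow>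
      (w[i := fst p, j := fst p, k := snd p] \<in> L \<longleftrightarrow> w[i := fst p, j := snd p, k := snd p] \<in> L))"
    using sat unfolding satisfies_aab_abb_iff[OF L] by force
  then obtain F2 where F2: "\<And>p. p \<in> A \<times> A \<Longrightarrow> finite (F2 p)"
    "\<And>p w i j k. p \<in> A \<times> A \<Longrightarrow> w \<in> lists A \<Longrightarrow> i < length w \<Longrightarrow> j < length w \<Longrightarrow> k < length w \<Longrightarrow>
      distinct [i, j, k] \<Longrightarrow> agree (F2 p) i j \<Longrightarrow> agree (F2 p) i k \<Longrightarrow>
      w[i := fst p, j := fst p, k := snd p] \<in> L \<longleftrightarrow> w[i := fst p, j := snd p, k := snd p] \<in> L"
    by metis
  have "\<forall>a\<in>A. \<exists>F. finite F \<and> (\<forall>w\<in>lists A. \<forall>i<length w. agree F i (length w) \<longrightarrow>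
      (w[i := a] \<in> L \<longleftrightarrow> w[i := a] @ [a] \<in> L))"
    using sat by (auto simp: satisfies_a_aa_iff[OF L])
  then obtain F3 where F3: "\<And>a. a \<in> A \<Longrightarrow> finite (F3 a)"
    "\<And>a w i. a \<in> A \<Longrightarrow> w \<in> lists A \<Longrightarrow> i < length w \<Longrightarrow> agree (F3 a) i (length w) \<Longrightarrow>
      w[i := a] \<in> L \<longleftrightarrow> w[i := a] @ [a] \<in> L"
    by metis
  define F where "F = (\<Union>p\<in>A \<times> A. F1 p \<union> F2 p) \<union> (\<Union>a\<in>A. F3 a)"
  have "finite F" unfolding F_def using fin F1(1) F2(1) F3(1) by blast
  moreover have "colour_invariant A L F"
  proof
    fix a b w i j
    assume "a \<in> A" "b \<in> A" "w \<in> lists A" "i < length w" "j < length w" "i \<noteq> j" and "agree F i j"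
    moreover have "agree (F1 (a, b)) i j"
      by (rule agree_mono[OF \<open>agree F i j\<close>]) (use \<open>a \<in> A\<close> \<open>b \<in> A\<close> in \<open>auto simp: F_def\<close>)
    ultimately show "w[i := a, j := b] \<in> L \<longleftrightarrow> w[i := b, j := a] \<in> L"
      using F1(2)[of "(a, b)"] by simp
  next
    fix a b w i j k
    assume "a \<in> A" "b \<in> A" "w \<in> lists A" "i < length w" "j < length w" "k < length w"
      "distinct [i, j, k]" and "agree F i j" and "agree F i k"
    moreover have "agree (F2 (a, b)) i j"
      by (rule agree_mono[OF \<open>agree F i j\<close>]) (use \<open>a \<in> A\<close> \<open>b \<in> A\<close> in \<open>auto simp: F_def\<close>)
    moreover have "agree (F2 (a, b)) i k"
      by (rule agree_mono[OF \<open>agree F i k\<close>]) (use \<open>a \<in> A\<close> \<open>b \<in> A\<close> in \<open>auto simp: F_def\<close>)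
    ultimately show "w[i := a, j := a, k := b] \<in> L \<longleftrightarrow> w[i := a, j := b, k := b] \<in> L"
      using F2(2)[of "(a, b)"] by simp
  next
    fix a w i
    assume "a \<in> A" "w \<in> lists A" "i < length w" and "agree F i (length w)"
    moreover have "agree (F3 a) i (length w)"
      by (rule agree_mono[OF \<open>agree F i (length w)\<close>]) (use \<open>a \<in> A\<close> in \<open>auto simp: F_def\<close>)
    ultimately show "w[i := a] \<in> L \<longleftrightarrow> w[i := a] @ [a] \<in> L"
      using F3(2) by simp
  qed
  ultimately show ?thesis by blast
qed

text \<open>A pair (letter, colour) belongs to the profile exactly when the letter occurs in that
  colour class, which is a generator condition with the class as \<open>Q\<close>. Only finitely
  many pairs are possible, so \<open>L\<close> is a finite Boolean combination of
  generators.\<close>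

lemma profile_invariant_in_lang_B1:
  assumes "finite A" "finite F" "L \<subseteq> lists A"
    and inv: "\<And>w w'. w \<in> lists A \<Longrightarrow> w' \<in> lists A \<Longrightarrow> profile F w = profile F w' \<Longrightarrow> w \<in> L \<longleftrightarrow> w' \<in> L"
  shows "L \<in> lang_B1 A"
  unfolding lang_B1_def hull_def
proof (intro InterI, clarify)
  fix T assume T: "algebra (lists A) T"
    and gen: "{{w \<in> lists A. positions a w \<inter> Q \<noteq> {}} | a Q. a \<in> A} \<subseteq> T"
  let ?X = "\<lambda>p. {w \<in> lists A. positions (fst p) w \<inter> {i. {Q \<in> F. i \<in> Q} = snd p} \<noteq> {}}"
  have X: "w \<in> ?X p \<longleftrightarrow> p \<in> profile F w" if "w \<in> lists A" for w p
    using that by (cases p) (auto simp: positions_def profile_def image_iff)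
  have sub: "profile F w \<subseteq> A \<times> Pow F" if "w \<in> lists A" for w
    using that by (auto simp: profile_def in_lists_conv_set)
  show "L \<in> T"
  proof (rule algebra.invariant_in_algebra[OF T, of "A \<times> Pow F" ?X])
    show "finite (A \<times> Pow F)" using assms by auto
    show "?X p \<in> T" if "p \<in> A \<times> Pow F" for p
      using that
      by (intro subsetD[OF gen] CollectI exI[of _ "fst p"] exI[of _ "{i. {Q \<in> F. i \<in> Q} = snd p}"] conjI refl)
        auto
    fix w w' assume w: "w \<in> lists A" "w' \<in> lists A" and eq: "\<forall>p\<in>A \<times> Pow F. w \<in> ?X p \<longleftrightarrow> w' \<in> ?X p"
      and "w \<in> L"
    have "profile F w = profile F w'" using eq sub w unfolding X[OF w(1)] X[OF w(2)] by blast
    then show "w' \<in> L" using inv w \<open>w \<in> L\<close> by blast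
  qed (fact assms)
qed

theorem mainTheorem9:
  fixes A :: "'a set" and L :: "'a list set"
  assumes "finite A" and "L \<subseteq> lists A"
  shows "L \<in> lang_B1 A \<longleftrightarrow>
    (\<forall>a\<in>A. \<forall>b\<in>A. satisfies L (eqs_ab_ba A a b) \<and> satisfies L (eqs_aab_abb A a b)
      \<and> satisfies L (eqs_a_aa A a))"
proof
  assume "L \<in> lang_B1 A"
  then show "\<forall>a\<in>A. \<forall>b\<in>A. satisfies L (eqs_ab_ba A a b) \<and> satisfies L (eqs_aab_abb A a b)
      \<and> satisfies L (eqs_a_aa A a)"
    by (simp add: lang_B1_satisfies)
next
  assume sat: "\<forall>a\<in>A. \<forall>b\<in>A. satisfies L (eqs_ab_ba A a b) \<and> satisfies L (eqs_aab_abb A a b)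
      \<and> satisfies L (eqs_a_aa A a)"
  obtain F where F: "finite F" "colour_invariant A L F"
    using satisfies_colour_invariant[OF assms sat] by blast
  obtain N where N: "\<And>i. i \<ge> N \<Longrightarrow> \<exists>j<N. agree F j i"
    using agree_bounded_representatives[OF F(1)] by blast
  show "L \<in> lang_B1 A"
  proof (rule profile_invariant_in_lang_B1[OF assms(1) _ assms(2)])
    show "finite (F \<union> (\<lambda>i. {i}) ` {..<N})" using F(1) by simp
  qed (rule colour_invariant.profile_determines[OF F(2) N])
qed

end
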